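(* Let $(S,\cdot)$ be an arbitrary semigroup and let $A\subseteq S$ be an $SCR$-set in $S$. Then the collection $D=\{(a_1,a_2,d)\in S\times S\times S: \{a_1d^ta_2: t\in\{1,2\}\}\subseteq A\}$ is a $CR$-set in the semigroup $S\times S\times S$ (with coordinatewise operation).
   Context: For a semigroup $T$, ${}^{\mathbb{N}}T$ denotes the set of functions $f:\mathbb{N}\to T$ and $\mathcal{P}_f(X)$ the set of finite nonempty subsets of $X$. A set $A\subseteq S$ is an $SCR$-set (strong combinatorially rich set) if for each $k\in\mathbb{N}$ there exists $r\in\mathbb{N}$ such that for each $F\in\mathcal{P}_f({}^{\mathbb{N}}S)$ with $|F|\le k$, there exist $(a_1,a_2)\in S^2$ and $t\in\mathbb{N}$ with $t\le r$ such that $a_1f(t)a_2\in A$ for each $f\in F$. A set $B\subseteq T$ in a semigroup $T$ is a $CR$-set (combinatorially rich set) if for each $k\in\mathbb{N}$ there exist $r\in\mathbb{N}$ and $m\in\mathbb{N}$ such that for each $F\in\mathcal{P}_f({}^{\mathbb{N}}T)$ with $|F|\le k$, there exist $(a_1,\dots,a_{m+1})\in T^{m+1}$ and $t_1<t_2<\dots<t_m\le r$ in $\mathbb{N}$ such that $a_1f(t_1)a_2f(t_2)\cdots a_mf(t_m)a_{m+1}\in B$ for each $f\in F$. *)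

theory Defs
  imports Main "HOL-Library.FuncSet"
begin

text \<open>
  Convention: the natural numbers of the source are the positive integers, so the range of
  indices is \<^term>\<open>{1::nat..}\<close>. Keeping 0 out matters: a combinatorially rich set
  with \<open>m = 0\<close> would merely be a nonempty set. The functions from the positive integers
  to the semigroup are the extensional functions below, so that distinct members of a family
  differ at some positive integer and \<^const>\<open>card\<close> counts functions on that domain.
\<close>

abbreviation sequences :: "(nat \<Rightarrow> 'a) set" where
  "sequences \<equiv> {1..} \<rightarrow>\<^sub>E UNIV"

instantiation prod :: (times, times) times
begin

definition times_prod_def: "x * y = (fst x * fst y, snd x * snd y)"

instance ..

end

instance prod :: (semigroup_mult, semigroup_mult) semigroup_mult
  by standard (simp add: times_prod_def mult.assoc)

text \<open>
  Powers without a neutral element: the intended range is \<open>n \<ge> 1\<close>, where the value is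
  the product of \<open>n\<close> copies of \<open>d\<close>.
\<close>

definition sg_power :: "'a::semigroup_mult \<Rightarrow> nat \<Rightarrow> 'a" where
  "sg_power d n = ((\<lambda>x. x * d) ^^ (n - 1)) d"

lemma sg_power_1: "sg_power d 1 = d"
  by (simp add: sg_power_def)

lemma sg_power_Suc: "n \<ge> 1 \<Longrightarrow> sg_power d (Suc n) = sg_power d n * d"
  by (cases n) (simp_all add: sg_power_def)

definition SCR_set :: "'a::semigroup_mult set \<Rightarrow> bool" where
  "SCR_set A \<longleftrightarrow>
    (\<forall>k::nat\<ge>1. \<exists>r::nat\<ge>1. \<forall>F \<subseteq> sequences. finite F \<and> F \<noteq> {} \<and> card F \<le> k \<longrightarrow>
      (\<exists>a1 a2. \<exists>t\<in>{1..r}. \<forall>f\<in>F. a1 * f t * a2 \<in> A))"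

text \<open>
  \<open>interleave a t f m\<close> is
  \<open>a 1 * f (t 1) * a 2 * f (t 2) * \<dots> * a m * f (t m) * a (m + 1)\<close>;
  it uses \<open>a\<close> only on \<open>{1..m + 1}\<close> and \<open>t\<close> only on \<open>{1..m}\<close>.
\<close>

primrec interleave :: "(nat \<Rightarrow> 'a::semigroup_mult) \<Rightarrow> (nat \<Rightarrow> nat) \<Rightarrow> (nat \<Rightarrow> 'a) \<Rightarrow> nat \<Rightarrow> 'a" where
  "interleave a t f 0 = a 1"
| "interleave a t f (Suc m) = interleave a t f m * f (t (Suc m)) * a (Suc (Suc m))"

definition CR_set :: "'a::semigroup_mult set \<Rightarrow> bool" where
  "CR_set B \<longleftrightarrow>
    (\<forall>k::nat\<ge>1. \<exists>r::nat\<ge>1. \<exists>m::nat\<ge>1. \<forall>F \<subseteq> sequences. finite F \<and> F \<noteq> {} \<and> card F \<le> k \<longrightarrow>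
      (\<exists>a t. strict_mono_on {1..m} t \<and> t ` {1..m} \<subseteq> {1..r} \<and>
        (\<forall>f\<in>F. interleave a t f m \<in> B)))"

end

theory Submission
  imports Defs
begin

text \<open>
  A single index \<open>t\<close> suffices (\<open>m = 1\<close>). Given \<open>f = (f1, f2, f3)\<close>, fill every inner slot with one
  fixed element \<open>p\<close> and set \<open>h t = p * f3 t * p\<close>. The two words \<open>f1 t * p * h t * p * f2 t\<close> and
  \<open>f1 t * p * h t * h t * p * f2 t\<close> are again sequences in \<open>t\<close>, at most \<open>2 * k\<close> of them in all.
  The hypothesis at \<open>2 * k\<close> multiplies them all into \<open>A\<close> by common outer factors, at a common \<open>t\<close>.
\<close>

theorem theorem2p7:
  fixes A :: "'a::semigroup_mult set"
  assumes "SCR_set A"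
  shows "CR_set {(a1, a2, d). {a1 * sg_power d t * a2 | t. t \<in> {1, 2}} \<subseteq> A}"
  unfolding CR_set_def
proof (intro allI impI)
  fix k :: nat
  assume "1 \<le> k"
  then have "1 \<le> 2 * k" by simp
  then obtain r where r: "1 \<le> r"
    and scr: "\<And>G. G \<subseteq> sequences \<Longrightarrow> finite G \<Longrightarrow> G \<noteq> {} \<Longrightarrow> card G \<le> 2 * k \<Longrightarrow>
      \<exists>a1 a2. \<exists>t\<in>{1..r}. \<forall>g\<in>G. a1 * g t * a2 \<in> A"
    using assms unfolding SCR_set_def by meson
  define B where "B = {(a1, a2, d). {a1 * sg_power d t * a2 | t. t \<in> {1, 2}} \<subseteq> A}"
  have B_iff: "(x, y, d) \<in> B \<longleftrightarrow> x * d * y \<in> A \<and> x * (d * d) * y \<in> A" for x y d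
  proof -
    have "{x * sg_power d t * y | t. t \<in> {1, 2}} = {x * sg_power d 1 * y, x * sg_power d 2 * y}"
      by blast
    moreover have "sg_power d 2 = d * d"
      by (simp add: sg_power_def)
    ultimately show ?thesis
      by (simp add: B_def sg_power_1 del: One_nat_def)
  qed
  \<comment> \<open>Any element would do; a semigroup need not have a unit to pad with.\<close>
  define p :: 'a where "p = undefined"
  define h where "h f t = p * snd (snd (f t)) * p" for f :: "nat \<Rightarrow> 'a \<times> 'a \<times> 'a" and t
  \<comment> \<open>Restricting to positive indices puts the words in \<open>sequences\<close>;
    their values at \<open>s \<ge> 1\<close> are unaffected.\<close>
  define w1 where "w1 f = (\<lambda>t\<in>{1..}. fst (f t) * p * h f t * p * fst (snd (f t)))" for f
  define w2 where "w2 f = (\<lambda>t\<in>{1..}. fst (f t) * p * (h f t * h f t) * p * fst (snd (f t)))" for f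
  have "\<exists>a t. strict_mono_on {1..1} t \<and> t ` {1..1} \<subseteq> {1..r} \<and> (\<forall>f\<in>F. interleave a t f 1 \<in> B)"
    if F: "F \<subseteq> sequences" "finite F \<and> F \<noteq> {} \<and> card F \<le> k" for F :: "(nat \<Rightarrow> 'a \<times> 'a \<times> 'a) set"
  proof -
    let ?G = "w1 ` F \<union> w2 ` F"
    have "card ?G \<le> card (w1 ` F) + card (w2 ` F)" by (rule card_Un_le)
    also have "\<dots> \<le> card F + card F"
      using F by (intro add_mono card_image_le) auto
    finally have "card ?G \<le> 2 * k" using F by simp
    moreover have "?G \<subseteq> sequences" by (auto simp: w1_def w2_def split: if_splits)
    ultimately obtain b e s where s: "s \<in> {1..r}" and in_A: "\<And>g. g \<in> ?G \<Longrightarrow> b * g s * e \<in> A"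
      using scr[of ?G] F by blast
    \<comment> \<open>\<open>b\<close> opens the first coordinate and \<open>e\<close> closes the
      second; the padding turns the third into \<open>h f s\<close>.\<close>
    define a where "a i = (if i = 1 then (b, p, p) else (p, e, p))" for i :: nat
    have "interleave a (\<lambda>_. s) f 1 \<in> B" if "f \<in> F" for f
    proof -
      have "interleave a (\<lambda>_. s) f 1 = (b * fst (f s) * p, p * fst (snd (f s)) * e, h f s)"
        by (simp add: a_def h_def times_prod_def)
      \<comment> \<open>By associativity, the two memberships in \<open>B_iff\<close> are those of
        \<open>b * w1 f s * e\<close> and \<open>b * w2 f s * e\<close> in \<open>A\<close>.\<close>
      then show ?thesis
        using in_A[of "w1 f"] in_A[of "w2 f"] that s
        by (simp add: B_iff w1_def w2_def mult.assoc)
    qed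
    then show ?thesis
      using s by (intro exI[of _ a] exI[of _ "\<lambda>_. s"]) (auto simp: strict_mono_on_def)
  qed
  then show "\<exists>r\<ge>1. \<exists>m\<ge>1. \<forall>F\<subseteq>sequences. finite F \<and> F \<noteq> {} \<and> card F \<le> k \<longrightarrow>
      (\<exists>a t. strict_mono_on {1..m} t \<and> t ` {1..m} \<subseteq> {1..r} \<and> (\<forall>f\<in>F. interleave a t f m \<in>
        {(a1, a2, d). {a1 * sg_power d t * a2 | t. t \<in> {1, 2}} \<subseteq> A}))"
    using r unfolding B_def by (meson order_refl)
qed

end
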